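(* Suppose that the modified Euler method is consistent with exponents $(\alpha_1,\alpha_2)$ for some $\alpha_1\ge1$, $\alpha_2\ge2$, and stable with parameter $p^\star\ge1$ and constants $K_3,\dots,K_6$ (notions defined in the context). Put $\tau_{\max}:=\min\{1/K_4,1\}$. Then for any integer $p\in[1,p^\star]$, $p\ge1$, there exists a constant $C$, independent of $n$ and $\tau$, such that for any $\tau\in(0,\tau_{\max})$ and all $n$, $$\mathbb{E}\big[|Y_{n+1}|^{2p}\,\big|\,\mathcal{F}_{t_n}\big]\le(1-K_4\tau/4)|Y_n|^{2p}+C\tau.$$
   Context: **Setting.** $b:\mathbb{R}^d\to\mathbb{R}^d$ and $\sigma=(\sigma_1,\dots,\sigma_m):\mathbb{R}^d\to\mathbb{R}^{d\times m}$ (columns $\sigma_j$) are measurable; $W=(W_1,\dots,W_m)$ is an $\mathbb{R}^m$-valued Wiener process on a complete filtered probability space $(\Omega,\mathcal{F},\{\mathcal{F}_t\}_{t\ge0},\mathbb{P})$. $|\cdot|$, $\langle\cdot,\cdot\rangle$ are the Euclidean norm and inner product. **Modified Euler method (MEM).** For a step size $\tau\in(0,1)$, let $\mathscr{P}:\mathbb{R}^d\to\mathbb{R}^d$ (possibly depending on $\tau$), $b_\tau:\mathbb{R}^d\to\mathbb{R}^d$ and $\sigma_{j,\tau}:\mathbb{R}^d\to\mathbb{R}^d$ ($1\le j\le m$) be measurable. With $t_n=n\tau$, $\delta W_{j,n}=W_j(t_{n+1})-W_j(t_n)$, and $\mathcal{F}_0$-measurable initial value $Y_0=x_0$, $$Y_{n+1}=\mathscr{P}(Y_n)+b_\tau(\mathscr{P}(Y_n))\tau+\sum_{j=1}^m\sigma_{j,\tau}(\mathscr{P}(Y_n))\,\delta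 W_{j,n}.$$ **Consistent with exponents $(\alpha_1,\alpha_2)$** ($\alpha_1\ge1,\alpha_2\ge2$): there is $C$ (independent of $\tau$) such that for all $x\in\mathbb{R}^d$ and $j$: $|b_\tau(\mathscr{P}(x))|\le C|b(x)|$; $|\sigma_{j,\tau}(\mathscr{P}(x))|\le C|\sigma_j(x)|$; $|b_\tau(\mathscr{P}(x))-b(\mathscr{P}(x))|+|\sigma_{j,\tau}(\mathscr{P}(x))-\sigma_j(\mathscr{P}(x))|\le C\tau(1+|x|^{\alpha_1})$; $|\mathscr{P}(x)|\le|x|$; $|\mathscr{P}(x)-x|\le C\tau^2|x|^{\alpha_2}$. **Stable with parameter $p^\star$**: there are positive constants $K_3,K_4,K_5,K_6$ and $\alpha_3<2$ (independent of $\tau$) such that for all $x\in\mathbb{R}^d$, $$2\langle\mathscr{P}(x),b_\tau(\mathscr{P}(x))\rangle+\binom{2p^\star}{2}\sum_{j=1}^m|\sigma_{j,\tau}(\mathscr{P}(x))|^2+\tau|b_\tau(\mathscr{P}(x))|^2\le K_3-K_4|\mathscr{P}(x)|^2,$$ $$\sqrt{\tau}\sum_{j=1}^m|\sigma_{j,\tau}(\mathscr{P}(x))|^2\le K_5+K_6|\mathscr{P}(x)|^{\alpha_3},$$ where $\binom{2p^\star}{2}=p^\star(2p^\star-1)$. *)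

theory Defs
  imports "HOL-Probability.Probability"
begin

section \<open>Complete filtered probability spaces and Wiener processes\<close>

text \<open>
  The time index set is $[0,\infty)$; the values of a filtration or a process at negative times
  are irrelevant and unconstrained.  Right-continuity of the filtration is not required.
\<close>

definition complete_filtered_prob_space :: "'a measure \<Rightarrow> (real \<Rightarrow> 'a measure) \<Rightarrow> bool" where
  "complete_filtered_prob_space M F \<longleftrightarrow>
     prob_space M \<and> complete_measure M \<and>
     (\<forall>t\<ge>0. subalgebra M (F t)) \<and>
     (\<forall>s t. 0 \<le> s \<and> s \<le> t \<longrightarrow> sets (F s) \<subseteq> sets (F t)) \<and>
     null_sets M \<subseteq> sets (F 0)"

definition wiener_process ::
  "'a measure \<Rightarrow> (real \<Rightarrow> 'a measure) \<Rightarrow> (real \<Rightarrow> 'a \<Rightarrow> real ^ 'm) \<Rightarrow> bool" where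
  "wiener_process M F W \<longleftrightarrow>
     (\<forall>t\<ge>0. W t \<in> borel_measurable (F t)) \<and>
     (AE \<omega> in M. W 0 \<omega> = 0) \<and>
     (AE \<omega> in M. continuous_on {0..} (\<lambda>t. W t \<omega>)) \<and>
     (\<forall>s t. 0 \<le> s \<and> s < t \<longrightarrow>
        prob_space.indep_set M (sets (F s))
          (sets (vimage_algebra (space M) (\<lambda>\<omega>. W t \<omega> - W s \<omega>) borel)) \<and>
        prob_space.indep_vars M (\<lambda>_. borel) (\<lambda>j \<omega>. (W t \<omega> - W s \<omega>) $ j) UNIV \<and>
        (\<forall>j. distributed M lborel (\<lambda>\<omega>. (W t \<omega> - W s \<omega>) $ j)
               (\<lambda>x. ennreal (normal_density 0 (sqrt (t - s)) x))))"


section \<open>The modified Euler method\<close>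

text \<open>
  The map \<open>P\<close> and the coefficients \<open>b\<^sub>\<tau>\<close>, \<open>\<sigma>\<^sub>j\<^sub>,\<^sub>\<tau>\<close> are families indexed by the step size: \<open>P \<tau>\<close>,
  \<open>b\<tau> \<tau>\<close>, \<open>\<sigma>\<tau> \<tau> j\<close>.
\<close>

primrec mem ::
  "(real \<Rightarrow> real ^ 'd \<Rightarrow> real ^ 'd) \<Rightarrow> (real \<Rightarrow> real ^ 'd \<Rightarrow> real ^ 'd) \<Rightarrow>
   (real \<Rightarrow> 'm \<Rightarrow> real ^ 'd \<Rightarrow> real ^ 'd) \<Rightarrow> (real \<Rightarrow> 'a \<Rightarrow> real ^ 'm) \<Rightarrow> ('a \<Rightarrow> real ^ 'd) \<Rightarrow>
   real \<Rightarrow> nat \<Rightarrow> 'a \<Rightarrow> real ^ 'd" where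
  "mem P b\<tau> \<sigma>\<tau> W x0 \<tau> 0 = x0"
| "mem P b\<tau> \<sigma>\<tau> W x0 \<tau> (Suc n) = (\<lambda>\<omega>.
     P \<tau> (mem P b\<tau> \<sigma>\<tau> W x0 \<tau> n \<omega>)
     + \<tau> *\<^sub>R b\<tau> \<tau> (P \<tau> (mem P b\<tau> \<sigma>\<tau> W x0 \<tau> n \<omega>))
     + (\<Sum>j\<in>UNIV. ((W (real (Suc n) * \<tau>) \<omega> - W (real n * \<tau>) \<omega>) $ j) *\<^sub>R
          \<sigma>\<tau> \<tau> j (P \<tau> (mem P b\<tau> \<sigma>\<tau> W x0 \<tau> n \<omega>))))"

definition mem_measurable ::
  "(real \<Rightarrow> real ^ 'd \<Rightarrow> real ^ 'd) \<Rightarrow> (real \<Rightarrow> real ^ 'd \<Rightarrow> real ^ 'd) \<Rightarrow>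
   (real \<Rightarrow> 'm \<Rightarrow> real ^ 'd \<Rightarrow> real ^ 'd) \<Rightarrow> bool" where
  "mem_measurable P b\<tau> \<sigma>\<tau> \<longleftrightarrow>
     (\<forall>\<tau>. 0 < \<tau> \<and> \<tau> < 1 \<longrightarrow>
        P \<tau> \<in> borel_measurable borel \<and> b\<tau> \<tau> \<in> borel_measurable borel \<and>
        (\<forall>j. \<sigma>\<tau> \<tau> j \<in> borel_measurable borel))"

definition mem_consistent ::
  "(real ^ 'd \<Rightarrow> real ^ 'd) \<Rightarrow> ('m \<Rightarrow> real ^ 'd \<Rightarrow> real ^ 'd) \<Rightarrow>
   (real \<Rightarrow> real ^ 'd \<Rightarrow> real ^ 'd) \<Rightarrow> (real \<Rightarrow> real ^ 'd \<Rightarrow> real ^ 'd) \<Rightarrow>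
   (real \<Rightarrow> 'm \<Rightarrow> real ^ 'd \<Rightarrow> real ^ 'd) \<Rightarrow> real \<Rightarrow> real \<Rightarrow> bool" where
  "mem_consistent b \<sigma> P b\<tau> \<sigma>\<tau> \<alpha>\<^sub>1 \<alpha>\<^sub>2 \<longleftrightarrow>
     (\<exists>C. \<forall>\<tau> x j. 0 < \<tau> \<and> \<tau> < 1 \<longrightarrow>
        norm (b\<tau> \<tau> (P \<tau> x)) \<le> C * norm (b x) \<and>
        norm (\<sigma>\<tau> \<tau> j (P \<tau> x)) \<le> C * norm (\<sigma> j x) \<and>
        norm (b\<tau> \<tau> (P \<tau> x) - b (P \<tau> x)) + norm (\<sigma>\<tau> \<tau> j (P \<tau> x) - \<sigma> j (P \<tau> x))
          \<le> C * \<tau> * (1 + norm x powr \<alpha>\<^sub>1) \<and>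
        norm (P \<tau> x) \<le> norm x \<and>
        norm (P \<tau> x - x) \<le> C * \<tau>\<^sup>2 * norm x powr \<alpha>\<^sub>2)"

text \<open>
  The exponent \<open>\<alpha>\<^sub>3\<close> below may be any real number smaller than 2, so the power $|P(x)|^{\alpha_3}$ needs a
  convention where $P(x) = 0$: \<open>0 powr 0\<close> is 0 in HOL, whereas $r^0 = 1$ for every $r$ here; and for
  \<open>\<alpha>\<^sub>3 < 0\<close> the power is undefined (infinite) at $P(x) = 0$, where the bound is then not imposed.
\<close>

definition rpow :: "real \<Rightarrow> real \<Rightarrow> real" where
  "rpow r a = (if a = 0 then 1 else r powr a)"

text \<open>The factor \<open>p\<^sup>\<star> (2 p\<^sup>\<star> - 1)\<close> is the binomial coefficient of \<open>2 p\<^sup>\<star>\<close> over 2; \<open>p\<^sup>\<star>\<close> is real.\<close>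

definition mem_stable ::
  "(real \<Rightarrow> real ^ 'd \<Rightarrow> real ^ 'd) \<Rightarrow> (real \<Rightarrow> real ^ 'd \<Rightarrow> real ^ 'd) \<Rightarrow>
   (real \<Rightarrow> 'm::finite \<Rightarrow> real ^ 'd \<Rightarrow> real ^ 'd) \<Rightarrow> real \<Rightarrow> real \<Rightarrow> real \<Rightarrow> real \<Rightarrow> real \<Rightarrow> bool" where
  "mem_stable P b\<tau> \<sigma>\<tau> pstar K\<^sub>3 K\<^sub>4 K\<^sub>5 K\<^sub>6 \<longleftrightarrow>
     0 < K\<^sub>3 \<and> 0 < K\<^sub>4 \<and> 0 < K\<^sub>5 \<and> 0 < K\<^sub>6 \<and>
     (\<exists>\<alpha>\<^sub>3<2. \<forall>\<tau> x. 0 < \<tau> \<and> \<tau> < 1 \<longrightarrow>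
        2 * (P \<tau> x \<bullet> b\<tau> \<tau> (P \<tau> x))
          + pstar * (2 * pstar - 1) * (\<Sum>j\<in>UNIV. (norm (\<sigma>\<tau> \<tau> j (P \<tau> x)))\<^sup>2)
          + \<tau> * (norm (b\<tau> \<tau> (P \<tau> x)))\<^sup>2
          \<le> K\<^sub>3 - K\<^sub>4 * (norm (P \<tau> x))\<^sup>2 \<and>
        (P \<tau> x \<noteq> 0 \<or> 0 \<le> \<alpha>\<^sub>3 \<longrightarrow>
          sqrt \<tau> * (\<Sum>j\<in>UNIV. (norm (\<sigma>\<tau> \<tau> j (P \<tau> x)))\<^sup>2)
            \<le> K\<^sub>5 + K\<^sub>6 * rpow (norm (P \<tau> x)) \<alpha>\<^sub>3))"

end

theory Submission
  imports Defs
begin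

text \<open>
  Conditionally on \<open>Y\<^sub>n = x\<close> the next iterate is \<open>a + \<xi>\<close> with \<open>a = y + \<tau> b\<^sub>\<tau>(y)\<close>, \<open>y = P(x)\<close>, and \<open>\<xi>\<close> a centred
  Gaussian vector with \<open>E|\<xi>|\<^sup>2 = \<tau> S\<close>, where \<open>S = \<Sum>\<^sub>j |\<sigma>\<^sub>j(y)|\<^sup>2\<close>.  Gaussian hypercontractivity gives
  \<open>E|a + \<xi>|\<^bsup>2p\<^esup> \<le> (|a|\<^sup>2 + (2p - 1) \<tau> S)\<^sup>p\<close>.  The first stability bound and \<open>2p - 1 \<le> p\<^sup>\<star> (2p\<^sup>\<star> - 1)\<close> bound
  the base by \<open>(1 - K\<^sub>4 \<tau>) |y|\<^sup>2 + K\<^sub>3 \<tau>\<close>, a convex combination of \<open>|y|\<^sup>2\<close> and \<open>K\<^sub>3 / K\<^sub>4\<close>, so convexity of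
  the \<open>p\<close>-th power and \<open>|y| \<le> |x|\<close> conclude.
\<close>

section \<open>Symmetrized powers and binomial coefficients\<close>

text \<open>The odd powers of \<open>v\<close> cancel in the symmetrized binomial expansion. What
  remains is a polynomial in \<open>v^2\<close> whose coefficients are nonnegative because
  \<open>u\<close> is, hence monotone in \<open>\<bar>v\<bar>\<close>.\<close>

lemma power_add_diff_mono:
  fixes u v w :: real
  assumes "0 \<le> u" "\<bar>v\<bar> \<le> w"
  shows "(u + v) ^ n + (u - v) ^ n \<le> (u + w) ^ n + (u - w) ^ n"
proof -
  have expand: "(u + z) ^ n + (u - z) ^ n
      = (\<Sum>k\<le>n. of_nat (n choose k) * (z ^ k + (- z) ^ k) * u ^ (n - k))" for z
    using binomial_ring[of z u n] binomial_ring[of "- z" u n]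
    by (simp add: algebra_simps sum.distrib[symmetric])
  have "v ^ k + (- v) ^ k \<le> w ^ k + (- w) ^ k" for k
    using power_mono[OF assms(2), of k] by (cases "even k") (simp_all add: power_even_abs)
  then show ?thesis
    unfolding expand using assms by (intro sum_mono mult_right_mono mult_left_mono) auto
qed

lemma even_binomial_expansion:
  fixes x y :: real
  shows "(x + y) ^ (2 * n) + (x - y) ^ (2 * n)
    = 2 * (\<Sum>k\<le>n. of_nat (2 * n choose (2 * k)) * y ^ (2 * k) * x ^ (2 * (n - k)))"
proof -
  define g where "g k = of_nat (2 * n choose k) * (y ^ k + (- y) ^ k) * x ^ (2 * n - k)" for k
  have "(x + y) ^ (2 * n) + (x - y) ^ (2 * n) = (\<Sum>k\<le>2 * n. g k)"
    using binomial_ring[of y x "2 * n"] binomial_ring[of "- y" x "2 * n"]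
    by (simp add: g_def algebra_simps sum.distrib[symmetric])
  \<comment> \<open>The extra term vanishes with its binomial coefficient. The index range now
    splits into pairs \<open>2 * k\<close>, \<open>2 * k + 1\<close>, and the odd member of each
    pair is zero.\<close>
  also have "\<dots> = (\<Sum>k\<le>Suc (2 * n). g k)"
    by (simp add: g_def)
  also have "\<dots> = (\<Sum>k\<le>n. g (2 * k) + g (Suc (2 * k)))"
    by (rule sum.in_pairs_0)
  also have "\<dots> = (\<Sum>k\<le>n. 2 * (of_nat (2 * n choose (2 * k)) * y ^ (2 * k) * x ^ (2 * (n - k))))"
    by (intro sum.cong) (simp_all add: g_def right_diff_distrib')
  finally show ?thesis by (simp add: sum_distrib_left)
qed

text \<open>
  For fixed norms of \<open>a\<close> and \<open>c\<close> the symmetrized power is largest when they are parallel, which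
  reduces the moment estimate to dimension one.
\<close>

lemma norm_add_sym_power_le:
  fixes a c :: "'v::real_inner"
  shows "norm (a + c) ^ (2 * n) + norm (a - c) ^ (2 * n)
    \<le> 2 * (\<Sum>k\<le>n. of_nat (2 * n choose (2 * k)) * norm c ^ (2 * k) * norm a ^ (2 * (n - k)))"
proof -
  define u where "u = (norm a)\<^sup>2 + (norm c)\<^sup>2"
  have norm_sq: "norm (a + c) ^ (2 * n) = (u + 2 * (a \<bullet> c)) ^ n" "norm (a - c) ^ (2 * n) = (u - 2 * (a \<bullet> c)) ^ n"
    unfolding u_def power_mult power2_norm_eq_inner
    by (auto intro!: arg_cong[where f = "\<lambda>x. x ^ n"] simp: inner_commute algebra_simps)
  have sq: "u + 2 * (norm a * norm c) = (norm a + norm c)\<^sup>2" "u - 2 * (norm a * norm c) = (norm a - norm c)\<^sup>2"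
    by (simp_all add: u_def power2_eq_square algebra_simps)
  \<comment> \<open>Both squared norms share the part \<open>u\<close> and differ only in the sign
    of the cross term, which Cauchy-Schwarz bounds by its value for parallel vectors.\<close>
  have "norm (a + c) ^ (2 * n) + norm (a - c) ^ (2 * n)
      \<le> (u + 2 * (norm a * norm c)) ^ n + (u - 2 * (norm a * norm c)) ^ n"
    unfolding norm_sq using Cauchy_Schwarz_ineq2[of a c]
    by (intro power_add_diff_mono) (auto simp: u_def abs_mult)
  also have "\<dots> = (norm a + norm c) ^ (2 * n) + (norm a - norm c) ^ (2 * n)"
    unfolding sq power_mult ..
  finally show ?thesis unfolding even_binomial_expansion .
qed

text \<open>The quotient \<open>fact (2 * k) / (2 ^ k * fact k)\<close> is the double factorial
  (2k-1)!!, the moment of order 2k of a standard normal variable. Dividing the left side by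
  \<open>n choose k\<close> leaves the product (2n-1)(2n-3)...(2n-2k+1), whose \<open>k\<close>
  factors are all at most \<open>L\<close>.\<close>

lemma even_binomial_normal_moment_le:
  fixes L :: real
  assumes "2 * real n - 1 \<le> L" "0 \<le> L" "k \<le> n"
  shows "of_nat (2 * n choose (2 * k)) * (fact (2 * k) / (2 ^ k * fact k)) \<le> of_nat (n choose k) * L ^ k"
proof -
  \<comment> \<open>The bound on that product, cleared of denominators so that induction on
    \<open>k\<close> adds one factor at a time.\<close>
  have fact_le: "fact (2 * n) * fact (n - k) \<le> fact n * (2 * L) ^ k * (fact (2 * (n - k)) :: real)"
    using \<open>k \<le> n\<close>
  proof (induction k)
    case (Suc k)
    define m where "m = n - Suc k"
    have m: "n - k = Suc m" using Suc.prems by (simp add: m_def)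
    have "real (Suc m) * (fact (2 * n) * fact m) \<le> fact n * (2 * L) ^ k * fact (2 * Suc m)"
      using Suc by (simp add: m algebra_simps)
    also have "\<dots> = real (Suc m) * (fact n * (2 * L) ^ k * (2 * (2 * real m + 1)) * fact (2 * m))"
      by (simp add: algebra_simps)
    finally have "fact (2 * n) * fact m \<le> fact n * (2 * L) ^ k * (2 * (2 * real m + 1)) * fact (2 * m)"
      by (subst (asm) mult_le_cancel_left_pos) auto
    \<comment> \<open>The new factor is 2m+1 = 2n-2k-1, at most 2n-1 and hence at most
      \<open>L\<close>.\<close>
    also have "\<dots> \<le> fact n * (2 * L) ^ k * (2 * L) * fact (2 * m)"
      using assms Suc.prems by (intro mult_right_mono mult_left_mono) (auto simp: m_def of_nat_diff)
    finally show ?case by (simp add: m_def mult_ac)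
  qed simp
  have "of_nat (2 * n choose (2 * k)) * (fact (2 * k) / (2 ^ k * fact k))
      = (fact (2 * n) * fact (n - k)) / (fact (2 * (n - k)) * 2 ^ k * fact k * fact (n - k) :: real)"
    using assms(3) binomial_fact[of "2 * k" "2 * n", where 'a = real]
    by (simp add: diff_mult_distrib2 divide_simps)
  also have "\<dots> \<le> (fact n * (2 * L) ^ k * fact (2 * (n - k))) / (fact (2 * (n - k)) * 2 ^ k * fact k * fact (n - k))"
    by (intro divide_right_mono fact_le) simp
  also have "\<dots> = of_nat (n choose k) * L ^ k"
    using assms(3) by (subst binomial_fact) (auto simp: field_simps power_mult_distrib)
  finally show ?thesis .
qed

section \<open>Moments of Gaussian vectors\<close>

text \<open>The parameter is the standard deviation, so the components of an increment over a time
  step \<open>\<tau>\<close> have law \<open>normal_measure (sqrt \<tau>)\<close>.\<close>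

abbreviation normal_measure :: "real \<Rightarrow> real measure" where
  "normal_measure s \<equiv> density lborel (\<lambda>x. ennreal (normal_density 0 s x))"

lemma nn_integral_normal_even_moment:
  assumes "0 < s"
  shows "(\<integral>\<^sup>+z. ennreal (z ^ (2 * k)) \<partial>normal_measure s) = ennreal (fact (2 * k) / (2 ^ k * fact k) * s ^ (2 * k))"
proof -
  have nonneg: "0 \<le> z ^ (2 * k)" for z :: real by (simp add: power_mult)
  have "(\<integral>\<^sup>+z. ennreal (z ^ (2 * k)) \<partial>normal_measure s) = (\<integral>\<^sup>+z. ennreal (normal_density 0 s z * z ^ (2 * k)) \<partial>lborel)"
    by (subst nn_integral_density) (auto simp: ennreal_mult'[symmetric] nonneg)
  also have "\<dots> = ennreal (fact (2 * k) / ((2 / s\<^sup>2) ^ k * fact k))"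
    using normal_moment_even[OF assms, of 0 k] nonneg
    by (subst nn_integral_eq_integral) (auto simp: has_bochner_integral_iff)
  also have "fact (2 * k) / ((2 / s\<^sup>2) ^ k * fact k) = fact (2 * k) / (2 ^ k * fact k) * s ^ (2 * k)"
    using assms by (simp add: power_divide power_mult[symmetric] field_simps)
  finally show ?thesis .
qed

text \<open>The density is even and Lebesgue measure is invariant under reflection. This lets an
  integrand be symmetrized in \<open>z\<close>.\<close>

lemma nn_integral_normal_uminus:
  assumes [measurable]: "f \<in> borel_measurable borel"
  shows "(\<integral>\<^sup>+z. f (- z) \<partial>normal_measure s) = (\<integral>\<^sup>+z. f z \<partial>normal_measure s)"
proof -
  have "(\<integral>\<^sup>+z. f z \<partial>normal_measure s) = (\<integral>\<^sup>+z. ennreal (normal_density 0 s z) * f z \<partial>distr lborel borel uminus)"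
    by (simp add: nn_integral_density lborel_distr_uminus)
  also have "\<dots> = (\<integral>\<^sup>+z. f (- z) \<partial>normal_measure s)"
    by (simp add: nn_integral_density nn_integral_distr normal_density_def)
  finally show ?thesis by simp
qed

text \<open>Symmetrizing in \<open>z\<close> leaves only even powers of \<open>z\<close>. Once their
  Gaussian moments are inserted, the sum is dominated term by term by the binomial expansion of the
  right side.\<close>

lemma normal_norm_power_moment_le:
  fixes a c :: "'v::euclidean_space"
  assumes "0 < s" "2 * real n - 1 \<le> L" "0 \<le> L"
  shows "(\<integral>\<^sup>+z. ennreal (norm (a + z *\<^sub>R c) ^ (2 * n)) \<partial>normal_measure s)
    \<le> ennreal (((norm a)\<^sup>2 + L * s\<^sup>2 * (norm c)\<^sup>2) ^ n)"
proof -
  let ?f = "\<lambda>z. ennreal (norm (a + z *\<^sub>R c) ^ (2 * n))"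
  define B where "B k = of_nat (2 * n choose (2 * k)) * norm c ^ (2 * k) * norm a ^ (2 * (n - k))" for k
  have B_nonneg: "0 \<le> B k" for k by (simp add: B_def)
  have "2 * (\<integral>\<^sup>+z. ?f z \<partial>normal_measure s) = (\<integral>\<^sup>+z. ?f z + ?f (- z) \<partial>normal_measure s)"
    using nn_integral_normal_uminus[of ?f s] by (simp add: nn_integral_add mult_2)
  also have "\<dots> \<le> (\<integral>\<^sup>+z. 2 * (\<Sum>k\<le>n. ennreal (B k) * ennreal (z ^ (2 * k))) \<partial>normal_measure s)"
  proof (intro nn_integral_mono)
    fix z :: real
    have "norm (a + z *\<^sub>R c) ^ (2 * n) + norm (a - z *\<^sub>R c) ^ (2 * n) \<le> 2 * (\<Sum>k\<le>n. B k * z ^ (2 * k))"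
      using norm_add_sym_power_le[of a "z *\<^sub>R c" n]
      by (simp add: B_def power_mult_distrib power_even_abs mult_ac)
    then have "?f z + ?f (- z) \<le> ennreal (2 * (\<Sum>k\<le>n. B k * z ^ (2 * k)))"
      by (simp add: ennreal_plus[symmetric] ennreal_leI del: ennreal_plus)
    also have "\<dots> = 2 * (\<Sum>k\<le>n. ennreal (B k) * ennreal (z ^ (2 * k)))"
      using B_nonneg by (simp add: ennreal_mult' ennreal_mult'' power_mult flip: sum_ennreal)
    finally show "?f z + ?f (- z) \<le> 2 * (\<Sum>k\<le>n. ennreal (B k) * ennreal (z ^ (2 * k)))" .
  qed
  also have "\<dots> = 2 * (\<Sum>k\<le>n. ennreal (B k) * (\<integral>\<^sup>+z. ennreal (z ^ (2 * k)) \<partial>normal_measure s))"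
    by (simp add: nn_integral_cmult nn_integral_sum)
  also have "\<dots> = 2 * (\<Sum>k\<le>n. ennreal (B k * (fact (2 * k) / (2 ^ k * fact k) * s ^ (2 * k))))"
    using assms(1) by (simp only: nn_integral_normal_even_moment ennreal_mult'[OF B_nonneg, symmetric])
  also have "\<dots> = 2 * ennreal (\<Sum>k\<le>n. B k * (fact (2 * k) / (2 ^ k * fact k) * s ^ (2 * k)))"
    using assms(1) B_nonneg by (subst sum_ennreal) auto
  also have "\<dots> \<le> 2 * ennreal (((norm a)\<^sup>2 + L * s\<^sup>2 * (norm c)\<^sup>2) ^ n)"
  proof (intro mult_left_mono ennreal_leI)
    have "(\<Sum>k\<le>n. B k * (fact (2 * k) / (2 ^ k * fact k) * s ^ (2 * k)))
        = (\<Sum>k\<le>n. of_nat (2 * n choose (2 * k)) * (fact (2 * k) / (2 ^ k * fact k))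
              * ((s\<^sup>2 * (norm c)\<^sup>2) ^ k * ((norm a)\<^sup>2) ^ (n - k)))"
      by (simp add: B_def power_mult_distrib mult_ac flip: power_mult)
    \<comment> \<open>Coefficient and moment together are replaced by
      \<open>(n choose k) * L ^ k\<close>, which turns the even half of an expansion of order 2n
      into a full expansion of order \<open>n\<close>.\<close>
    also have "\<dots> \<le> (\<Sum>k\<le>n. of_nat (n choose k) * L ^ k * ((s\<^sup>2 * (norm c)\<^sup>2) ^ k * ((norm a)\<^sup>2) ^ (n - k)))"
      using assms by (intro sum_mono mult_right_mono even_binomial_normal_moment_le) auto
    also have "\<dots> = (L * s\<^sup>2 * (norm c)\<^sup>2 + (norm a)\<^sup>2) ^ n"
      by (subst binomial_ring) (simp add: power_mult_distrib mult_ac)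
    finally show "(\<Sum>k\<le>n. B k * (fact (2 * k) / (2 ^ k * fact k) * s ^ (2 * k)))
        \<le> ((norm a)\<^sup>2 + L * s\<^sup>2 * (norm c)\<^sup>2) ^ n"
      by (simp add: add.commute)
  qed simp
  finally show ?thesis
    by (subst (asm) ennreal_mult_le_mult_iff) auto
qed

text \<open>
  Letting \<open>L\<close> vary independently of \<open>n\<close> makes the induction hypothesis available, with the same \<open>L\<close>, for
  all the lower moments that arise from the binomial expansion.
\<close>

lemma gaussian_norm_power_moment_le:
  fixes a :: "'v::euclidean_space" and c :: "'j \<Rightarrow> 'v"
  assumes "finite J" "0 < s" "2 * real n - 1 \<le> L" "0 \<le> L"
  shows "(\<integral>\<^sup>+z. ennreal (norm (a + (\<Sum>j\<in>J. z j *\<^sub>R c j)) ^ (2 * n)) \<partial>(\<Pi>\<^sub>M j\<in>J. normal_measure s))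
    \<le> ennreal (((norm a)\<^sup>2 + L * s\<^sup>2 * (\<Sum>j\<in>J. (norm (c j))\<^sup>2)) ^ n)"
  using assms(1,3)
proof (induction J arbitrary: n rule: finite_induct)
  case empty
  then show ?case
    by (simp add: product_sigma_finite.nn_integral_empty PiM_empty power_mult)
next
  case (insert i J)
  interpret N: prob_space "normal_measure s"
    by (rule prob_space_normal_density) (rule assms)
  interpret product_sigma_finite "\<lambda>_::'j. normal_measure s"
    by standard
  let ?\<xi> = "\<lambda>z. a + (\<Sum>j\<in>J. z j *\<^sub>R c j)"
  \<comment> \<open>\<open>A\<close> is the base of the bound for the directions in
    \<open>J\<close>, and \<open>D\<close> is what the new direction \<open>i\<close> adds to
    it.\<close>
  define A D where "A = (norm a)\<^sup>2 + L * s\<^sup>2 * (\<Sum>j\<in>J. (norm (c j))\<^sup>2)" and "D = L * s\<^sup>2 * (norm (c i))\<^sup>2"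
  have nonneg: "0 \<le> A" "0 \<le> D"
    using assms by (auto simp: A_def D_def intro!: add_nonneg_nonneg mult_nonneg_nonneg sum_nonneg)
  have "(\<integral>\<^sup>+z. ennreal (norm (a + (\<Sum>j\<in>insert i J. z j *\<^sub>R c j)) ^ (2 * n)) \<partial>(\<Pi>\<^sub>M j\<in>insert i J. normal_measure s))
      = (\<integral>\<^sup>+z. (\<integral>\<^sup>+y. ennreal (norm (?\<xi> z + y *\<^sub>R c i) ^ (2 * n)) \<partial>normal_measure s) \<partial>(\<Pi>\<^sub>M j\<in>J. normal_measure s))"
  proof (subst product_nn_integral_insert)
    show "(\<lambda>z. ennreal (norm (a + (\<Sum>j\<in>insert i J. z j *\<^sub>R c j)) ^ (2 * n)))
        \<in> borel_measurable (\<Pi>\<^sub>M j\<in>insert i J. normal_measure s)"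
      by measurable
    have "(\<Sum>j\<in>insert i J. (z(i := y)) j *\<^sub>R c j) = (\<Sum>j\<in>J. z j *\<^sub>R c j) + y *\<^sub>R c i" for z y
      using insert.hyps by (auto intro!: sum.cong simp: add.commute)
    then show "(\<integral>\<^sup>+z. (\<integral>\<^sup>+y. ennreal (norm (a + (\<Sum>j\<in>insert i J. (z(i := y)) j *\<^sub>R c j)) ^ (2 * n)) \<partial>normal_measure s)
        \<partial>(\<Pi>\<^sub>M j\<in>J. normal_measure s))
      = (\<integral>\<^sup>+z. (\<integral>\<^sup>+y. ennreal (norm (?\<xi> z + y *\<^sub>R c i) ^ (2 * n)) \<partial>normal_measure s) \<partial>(\<Pi>\<^sub>M j\<in>J. normal_measure s))"
      by (simp add: add.assoc)
  qed (use insert.hyps in auto)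
  also have "\<dots> \<le> (\<integral>\<^sup>+z. ennreal (((norm (?\<xi> z))\<^sup>2 + D) ^ n) \<partial>(\<Pi>\<^sub>M j\<in>J. normal_measure s))"
    unfolding D_def using assms insert.prems by (intro nn_integral_mono normal_norm_power_moment_le)
  also have "\<dots> = (\<integral>\<^sup>+z. (\<Sum>k\<le>n. ennreal (of_nat (n choose k) * D ^ (n - k)) * ennreal (norm (?\<xi> z) ^ (2 * k)))
      \<partial>(\<Pi>\<^sub>M j\<in>J. normal_measure s))"
    using nonneg
    by (intro nn_integral_cong) (simp add: binomial_ring ennreal_mult''[symmetric] power_mult[symmetric] mult_ac)
  also have "\<dots> = (\<Sum>k\<le>n. ennreal (of_nat (n choose k) * D ^ (n - k)) *
      (\<integral>\<^sup>+z. ennreal (norm (?\<xi> z) ^ (2 * k)) \<partial>(\<Pi>\<^sub>M j\<in>J. normal_measure s)))"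
    by (subst nn_integral_sum) (auto simp: nn_integral_cmult)
  also have "\<dots> \<le> (\<Sum>k\<le>n. ennreal (of_nat (n choose k) * D ^ (n - k)) * ennreal (A ^ k))"
    unfolding A_def using insert.prems by (intro sum_mono mult_left_mono insert.IH) auto
  also have "\<dots> = ennreal ((A + D) ^ n)"
    using nonneg by (simp add: binomial_ring ennreal_mult''[symmetric] mult_ac)
  also have "A + D = (norm a)\<^sup>2 + L * s\<^sup>2 * (\<Sum>j\<in>insert i J. (norm (c j))\<^sup>2)"
    using insert.hyps by (simp add: A_def D_def algebra_simps)
  finally show ?case .
qed

section \<open>Convexity, conditioning and the law of the increments\<close>

lemma convex_combination_power_le:
  fixes x y t :: real
  assumes "0 \<le> x" "0 \<le> y" "0 \<le> t" "t \<le> 1"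
  shows "((1 - t) * x + t * y) ^ n \<le> (1 - t) * x ^ n + t * y ^ n"
proof -
  \<comment> \<open>Even powers are convex on the whole line, odd powers in general only on the
    half-line, hence the case distinction.\<close>
  have "convex_on {0::real..} (\<lambda>x. x ^ n)"
    by (cases "even n") (auto intro: convex_power_odd convex_on_subset[OF convex_power_even])
  from convex_onD[OF this, of t x y] show ?thesis
    using assms by simp
qed

text \<open>The freezing rule: a quantity known to \<open>G\<close> is treated as a constant while
  the variable independent of \<open>G\<close> is integrated out. Independence makes a joint law a
  product measure, and Tonelli does the rest.\<close>

lemma (in prob_space) nn_cond_exp_indep:
  assumes sub: "subalgebra M G"
    and [measurable]: "Y \<in> measurable G N" "X \<in> measurable M N'"
    and indep: "indep_set (sets G) (sets (vimage_algebra (space M) X N'))"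
    and [measurable]: "(\<lambda>(y, x). f y x) \<in> borel_measurable (N \<Otimes>\<^sub>M N')"
  shows "AE \<omega> in M. nn_cond_exp M G (\<lambda>\<omega>. f (Y \<omega>) (X \<omega>)) \<omega> = (\<integral>\<^sup>+x. f (Y \<omega>) x \<partial>distr M N' X)"
proof -
  interpret finite_measure_subalgebra M G
    by standard (rule sub)
  interpret X: prob_space "distr M N' X"
    by (rule prob_space_distr) simp
  have id: "(\<lambda>\<omega>. \<omega>) \<in> measurable M G"
    using sub by (auto simp: subalgebra_def measurable_def)
  have Y: "Y \<in> measurable M N"
    by (rule measurable_from_subalg[OF sub]) simp
  \<comment> \<open>The identity into \<open>G\<close>, rather than \<open>Y\<close>, is paired with
    \<open>X\<close>: every event of \<open>G\<close> then becomes an event of the first coordinate,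
    as testing a conditional expectation requires.\<close>
  have joint: "distr M G (\<lambda>\<omega>. \<omega>) \<Otimes>\<^sub>M distr M N' X = distr M (G \<Otimes>\<^sub>M N') (\<lambda>\<omega>. (\<omega>, X \<omega>))"
  proof (rule pair_measure_eqI)
    show "sigma_finite_measure (distr M G (\<lambda>\<omega>. \<omega>))"
      by (intro prob_space_imp_sigma_finite prob_space_distr id)
    show "sigma_finite_measure (distr M N' X)"
      by (rule X.sigma_finite_measure_axioms)
    fix A B assume "A \<in> sets (distr M G (\<lambda>\<omega>. \<omega>))" "B \<in> sets (distr M N' X)"
    then have A: "A \<in> sets G" and B[measurable]: "B \<in> sets N'" by auto
    have "A \<subseteq> space M" and [measurable]: "A \<in> sets M"
      using A sub sets.sets_into_space by (auto simp: subalgebra_def)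
    have "X -` B \<inter> space M \<in> sets (vimage_algebra (space M) X N')"
      using B by (rule in_vimage_algebra)
    from indep_setD[OF indep A this] have "prob (A \<inter> (X -` B \<inter> space M)) = prob A * prob (X -` B \<inter> space M)" .
    moreover have "(\<lambda>\<omega>. (\<omega>, X \<omega>)) -` (A \<times> B) \<inter> space M = A \<inter> (X -` B \<inter> space M)"
        "(\<lambda>\<omega>. \<omega>) -` A \<inter> space M = A"
      using \<open>A \<subseteq> space M\<close> by auto
    ultimately show "emeasure (distr M G (\<lambda>\<omega>. \<omega>)) A * emeasure (distr M N' X) B
        = emeasure (distr M (G \<Otimes>\<^sub>M N') (\<lambda>\<omega>. (\<omega>, X \<omega>))) (A \<times> B)"
      using A B id by (simp add: emeasure_distr emeasure_eq_measure ennreal_mult'')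
  qed simp
  have "AE \<omega> in M. (\<integral>\<^sup>+x. f (Y \<omega>) x \<partial>distr M N' X) = nn_cond_exp M G (\<lambda>\<omega>. f (Y \<omega>) (X \<omega>)) \<omega>"
  proof (rule nn_cond_exp_charact)
    show "(\<lambda>\<omega>. f (Y \<omega>) (X \<omega>)) \<in> borel_measurable M"
      using Y by measurable
    show "(\<lambda>\<omega>. \<integral>\<^sup>+x. f (Y \<omega>) x \<partial>distr M N' X) \<in> borel_measurable G"
      by measurable
    fix A assume [measurable]: "A \<in> sets G"
    \<comment> \<open>The test event enters through the first coordinate only, so the inner integral
      over \<open>x\<close> does not affect it.\<close>
    let ?h = "\<lambda>(\<omega>, x). f (Y \<omega>) x * indicator A \<omega>"
    have [measurable]: "?h \<in> borel_measurable (G \<Otimes>\<^sub>M N')"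
      by measurable
    have "(\<integral>\<^sup>+\<omega>\<in>A. f (Y \<omega>) (X \<omega>) \<partial>M) = (\<integral>\<^sup>+z. ?h z \<partial>distr M (G \<Otimes>\<^sub>M N') (\<lambda>\<omega>. (\<omega>, X \<omega>)))"
      using id by (subst nn_integral_distr) auto
    also have "\<dots> = (\<integral>\<^sup>+\<omega>. (\<integral>\<^sup>+x. ?h (\<omega>, x) \<partial>distr M N' X) \<partial>distr M G (\<lambda>\<omega>. \<omega>))"
      unfolding joint[symmetric] by (subst X.nn_integral_fst) auto
    also have "\<dots> = (\<integral>\<^sup>+\<omega>\<in>A. (\<integral>\<^sup>+x. f (Y \<omega>) x \<partial>distr M N' X) \<partial>M)"
      using id by (subst nn_integral_distr) (auto intro!: nn_integral_cong split: split_indicator)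
    finally show "(\<integral>\<^sup>+\<omega>\<in>A. f (Y \<omega>) (X \<omega>) \<partial>M) = (\<integral>\<^sup>+\<omega>\<in>A. (\<integral>\<^sup>+x. f (Y \<omega>) x \<partial>distr M N' X) \<partial>M)" .
  qed
  then show ?thesis by (auto elim: AE_mp)
qed

lemma borel_measurable_vec_nth [measurable]:
  "(\<lambda>x :: real ^ 'm. x $ j) \<in> borel_measurable borel"
  by (intro borel_measurable_continuous_onI continuous_intros)

text \<open>Independence of the components makes their joint law the product of the marginals, the
  form in which the Gaussian moment bound is stated.\<close>

lemma (in prob_space) nn_integral_indep_normal_components:
  fixes X :: "'a \<Rightarrow> real ^ 'm"
  assumes [measurable]: "X \<in> borel_measurable M"
    and indep: "indep_vars (\<lambda>_. borel) (\<lambda>j \<omega>. X \<omega> $ j) UNIV"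
    and dist: "\<And>j. distributed M lborel (\<lambda>\<omega>. X \<omega> $ j) (\<lambda>x. ennreal (normal_density 0 s x))"
    and [measurable]: "f \<in> borel_measurable borel"
  shows "(\<integral>\<^sup>+x. f x \<partial>distr M borel X) = (\<integral>\<^sup>+z. f (\<chi> j. z j) \<partial>(\<Pi>\<^sub>M j\<in>UNIV. normal_measure s))"
proof -
  have comp: "distr M borel (\<lambda>\<omega>. X \<omega> $ j) = normal_measure s" for j
    using distributed_distr_eq_density[OF dist[of j]] by (metis distr_cong sets_lborel)
  have [measurable]: "(\<lambda>\<omega>. X \<omega> $ j) \<in> borel_measurable M" for j
    by (rule measurable_compose[OF _ borel_measurable_vec_nth]) simp
  have [measurable]: "(\<lambda>z. \<chi> j. z j) \<in> borel_measurable (\<Pi>\<^sub>M j\<in>(UNIV::'m set). (borel :: real measure))"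
    by (subst borel_measurable_euclidean_space) (auto simp: Basis_vec_def inner_axis)
  have "distr M (\<Pi>\<^sub>M j\<in>UNIV. borel) (\<lambda>\<omega>. \<lambda>j\<in>UNIV. X \<omega> $ j) = (\<Pi>\<^sub>M j\<in>UNIV. distr M borel (\<lambda>\<omega>. X \<omega> $ j))"
    using indep by (subst (asm) indep_vars_iff_distr_eq_PiM) auto
  then have "(\<integral>\<^sup>+z. f (\<chi> j. z j) \<partial>(\<Pi>\<^sub>M j\<in>UNIV. normal_measure s))
      = (\<integral>\<^sup>+z. f (\<chi> j. z j) \<partial>distr M (\<Pi>\<^sub>M j\<in>UNIV. borel) (\<lambda>\<omega>. \<lambda>j\<in>UNIV. X \<omega> $ j))"
    by (simp only: comp)
  also have "\<dots> = (\<integral>\<^sup>+\<omega>. f (X \<omega>) \<partial>M)"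
  proof (subst nn_integral_distr)
    show "(\<lambda>\<omega>. \<lambda>j\<in>UNIV. X \<omega> $ j) \<in> measurable M (\<Pi>\<^sub>M j\<in>UNIV. borel)"
      by (intro measurable_restrict) simp
  qed (simp_all add: restrict_UNIV)
  also have "\<dots> = (\<integral>\<^sup>+x. f x \<partial>distr M borel X)"
    by (simp add: nn_integral_distr)
  finally show ?thesis ..
qed

section \<open>One step of the method: drift bound and measurability\<close>

text \<open>Expanding the square gives \<open>norm y ^ 2\<close> plus \<open>\<tau>\<close> times
  the two drift terms of the stability condition. The bound is therefore that condition multiplied
  by \<open>\<tau>\<close>, with its diffusion coefficient lowered to \<open>L\<close>.\<close>

lemma mem_stable_drift_bound:
  assumes "mem_stable P b\<tau> \<sigma>\<tau> pstar K\<^sub>3 K\<^sub>4 K\<^sub>5 K\<^sub>6" "0 < \<tau>" "\<tau> < 1"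
    and "L \<le> pstar * (2 * pstar - 1)"
  shows "(norm (P \<tau> x + \<tau> *\<^sub>R b\<tau> \<tau> (P \<tau> x)))\<^sup>2 + L * \<tau> * (\<Sum>j\<in>UNIV. (norm (\<sigma>\<tau> \<tau> j (P \<tau> x)))\<^sup>2)
    \<le> (1 - K\<^sub>4 * \<tau>) * (norm (P \<tau> x))\<^sup>2 + K\<^sub>3 * \<tau>"
proof -
  let ?y = "P \<tau> x"
  define S where "S = (\<Sum>j\<in>UNIV. (norm (\<sigma>\<tau> \<tau> j ?y))\<^sup>2)"
  have "0 \<le> S" by (simp add: S_def sum_nonneg)
  have "2 * (?y \<bullet> b\<tau> \<tau> ?y) + pstar * (2 * pstar - 1) * S + \<tau> * (norm (b\<tau> \<tau> ?y))\<^sup>2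
      \<le> K\<^sub>3 - K\<^sub>4 * (norm ?y)\<^sup>2"
    using assms(1-3) unfolding mem_stable_def S_def by blast
  moreover have "L * S \<le> pstar * (2 * pstar - 1) * S"
    using assms(4) \<open>0 \<le> S\<close> by (rule mult_right_mono)
  ultimately have "\<tau> * (2 * (?y \<bullet> b\<tau> \<tau> ?y) + L * S + \<tau> * (norm (b\<tau> \<tau> ?y))\<^sup>2)
      \<le> \<tau> * (K\<^sub>3 - K\<^sub>4 * (norm ?y)\<^sup>2)"
    using assms(2) by (intro mult_left_mono) auto
  moreover have "(norm (?y + \<tau> *\<^sub>R b\<tau> \<tau> ?y))\<^sup>2
      = (norm ?y)\<^sup>2 + 2 * \<tau> * (?y \<bullet> b\<tau> \<tau> ?y) + \<tau>\<^sup>2 * (norm (b\<tau> \<tau> ?y))\<^sup>2"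
    unfolding power2_norm_eq_inner
    by (simp add: inner_commute power2_eq_square algebra_simps)
  ultimately show ?thesis
    unfolding S_def[symmetric] by (simp add: power2_eq_square algebra_simps)
qed

text \<open>The increment is a separate variable \<open>z\<close>, so that the same statement serves
  both adaptedness and the joint measurability needed for freezing.\<close>

lemma euler_step_measurable:
  fixes P b :: "real ^ 'd \<Rightarrow> real ^ 'd" and \<sigma> :: "'m::finite \<Rightarrow> real ^ 'd \<Rightarrow> real ^ 'd"
  assumes "P \<in> borel_measurable borel" "b \<in> borel_measurable borel" "\<And>j. \<sigma> j \<in> borel_measurable borel"
  shows "(\<lambda>(x, z). P x + h *\<^sub>R b (P x) + (\<Sum>j\<in>UNIV. (z $ j) *\<^sub>R \<sigma> j (P x))) \<in> borel_measurable (borel \<Otimes>\<^sub>M borel)"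
proof -
  have P: "(\<lambda>w. P (fst w)) \<in> borel_measurable (borel \<Otimes>\<^sub>M (borel :: (real ^ 'm) measure))"
    by (rule measurable_compose[OF measurable_fst assms(1)])
  show ?thesis
    unfolding case_prod_beta
    by (intro borel_measurable_add borel_measurable_sum borel_measurable_scaleR borel_measurable_const P
        measurable_compose[OF P] measurable_compose[OF measurable_snd borel_measurable_vec_nth] assms)
qed

text \<open>By induction: the current iterate and the next increment are both measurable at the
  later time, and the step is a jointly measurable function of the two.\<close>

lemma mem_adapted:
  assumes filt: "complete_filtered_prob_space M F" and wiener: "wiener_process M F W"
    and meas: "mem_measurable P b\<tau> \<sigma>\<tau>" and x0: "x0 \<in> borel_measurable (F 0)"
    and \<tau>: "0 < \<tau>" "\<tau> < 1"
  shows "mem P b\<tau> \<sigma>\<tau> W x0 \<tau> n \<in> borel_measurable (F (real n * \<tau>))"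
proof (induction n)
  case 0
  then show ?case using x0 by simp
next
  case (Suc n)
  define s t where "s = real n * \<tau>" and "t = real (Suc n) * \<tau>"
  have st: "0 \<le> s" "s \<le> t" using \<tau> by (auto simp: s_def t_def mult_right_mono)
  have "subalgebra M (F s)" "subalgebra M (F t)" "sets (F s) \<subseteq> sets (F t)"
    using filt st by (auto simp: complete_filtered_prob_space_def)
  then have sub: "subalgebra (F t) (F s)"
    by (simp add: subalgebra_def)
  have [measurable]: "mem P b\<tau> \<sigma>\<tau> W x0 \<tau> n \<in> borel_measurable (F t)"
    using Suc measurable_from_subalg[OF sub] by (simp add: s_def)
  have "W s \<in> borel_measurable (F s)" and [measurable]: "W t \<in> borel_measurable (F t)"
    using wiener st by (auto simp: wiener_process_def)
  then have [measurable]: "W s \<in> borel_measurable (F t)"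
    using measurable_from_subalg[OF sub] by blast
  have pair: "(\<lambda>\<omega>. (mem P b\<tau> \<sigma>\<tau> W x0 \<tau> n \<omega>, W t \<omega> - W s \<omega>)) \<in> measurable (F t) (borel \<Otimes>\<^sub>M borel)"
    by measurable
  have step: "(\<lambda>(x, z). P \<tau> x + \<tau> *\<^sub>R b\<tau> \<tau> (P \<tau> x) + (\<Sum>j\<in>UNIV. (z $ j) *\<^sub>R \<sigma>\<tau> \<tau> j (P \<tau> x)))
      \<in> borel_measurable (borel \<Otimes>\<^sub>M borel)"
    using meas \<tau> by (intro euler_step_measurable) (auto simp: mem_measurable_def)
  show ?case
    unfolding mem.simps s_def[symmetric] t_def[symmetric]
    using measurable_compose[OF pair step] by (simp only: prod.case)
qed

section \<open>The one-step conditional moment bound\<close>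

theorem theorem3p2:
  fixes M :: "'a measure"
    and F :: "real \<Rightarrow> 'a measure"
    and W :: "real \<Rightarrow> 'a \<Rightarrow> real ^ 'm"
    and b :: "real ^ 'd \<Rightarrow> real ^ 'd"
    and \<sigma> :: "'m \<Rightarrow> real ^ 'd \<Rightarrow> real ^ 'd"
    and P b\<tau> :: "real \<Rightarrow> real ^ 'd \<Rightarrow> real ^ 'd"
    and \<sigma>\<tau> :: "real \<Rightarrow> 'm \<Rightarrow> real ^ 'd \<Rightarrow> real ^ 'd"
    and x0 :: "'a \<Rightarrow> real ^ 'd"
    and \<alpha>\<^sub>1 \<alpha>\<^sub>2 pstar K\<^sub>3 K\<^sub>4 K\<^sub>5 K\<^sub>6 :: real
    and p :: nat
  assumes "complete_filtered_prob_space M F"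
    and "wiener_process M F W"
    and "b \<in> borel_measurable borel"
    and "\<And>j. \<sigma> j \<in> borel_measurable borel"
    and "mem_measurable P b\<tau> \<sigma>\<tau>"
    and "x0 \<in> borel_measurable (F 0)"
    and "\<alpha>\<^sub>1 \<ge> 1" and "\<alpha>\<^sub>2 \<ge> 2"
    and "mem_consistent b \<sigma> P b\<tau> \<sigma>\<tau> \<alpha>\<^sub>1 \<alpha>\<^sub>2"
    and "pstar \<ge> 1"
    and "mem_stable P b\<tau> \<sigma>\<tau> pstar K\<^sub>3 K\<^sub>4 K\<^sub>5 K\<^sub>6"
    and "1 \<le> p" and "real p \<le> pstar"
  shows "\<exists>C>0. \<forall>\<tau>. 0 < \<tau> \<and> \<tau> < min (1 / K\<^sub>4) 1 \<longrightarrow>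
           (\<forall>n. AE \<omega> in M.
              nn_cond_exp M (F (real n * \<tau>))
                (\<lambda>\<omega>. ennreal (norm (mem P b\<tau> \<sigma>\<tau> W x0 \<tau> (Suc n) \<omega>) ^ (2 * p))) \<omega>
              \<le> ennreal ((1 - K\<^sub>4 * \<tau> / 4) * norm (mem P b\<tau> \<sigma>\<tau> W x0 \<tau> n \<omega>) ^ (2 * p) + C * \<tau>))"
proof -
  interpret prob_space M
    using assms(1) by (simp add: complete_filtered_prob_space_def)
  have K: "0 < K\<^sub>3" "0 < K\<^sub>4" using assms(11) by (auto simp: mem_stable_def)
  define L where "L = 2 * real p - 1"
  have L: "0 \<le> L" "L \<le> pstar * (2 * pstar - 1)"
  proof -
    show "0 \<le> L" using assms(12) by (simp add: L_def)
    have "L \<le> 1 * (2 * pstar - 1)" using assms(13) by (simp add: L_def)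
    also have "\<dots> \<le> pstar * (2 * pstar - 1)" using assms(10) by (intro mult_right_mono) auto
    finally show "L \<le> pstar * (2 * pstar - 1)" .
  qed
  \<comment> \<open>The constant left by convexity: the weight \<open>K\<^sub>4 * \<tau>\<close>
    times the \<open>p\<close>-th power of \<open>K\<^sub>3 / K\<^sub>4\<close> is
    \<open>C * \<tau>\<close>.\<close>
  define C where "C = K\<^sub>4 * (K\<^sub>3 / K\<^sub>4) ^ p"
  have "0 < C" using K by (simp add: C_def)
  moreover have "AE \<omega> in M.
      nn_cond_exp M (F (real n * \<tau>)) (\<lambda>\<omega>. ennreal (norm (mem P b\<tau> \<sigma>\<tau> W x0 \<tau> (Suc n) \<omega>) ^ (2 * p))) \<omega>
      \<le> ennreal ((1 - K\<^sub>4 * \<tau> / 4) * norm (mem P b\<tau> \<sigma>\<tau> W x0 \<tau> n \<omega>) ^ (2 * p) + C * \<tau>)"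
    if \<tau>: "0 < \<tau> \<and> \<tau> < min (1 / K\<^sub>4) 1" for \<tau> n
  proof -
    \<comment> \<open>The restriction on the step size makes \<open>K\<^sub>4 * \<tau>\<close> an
      admissible convex weight.\<close>
    have \<tau>01: "0 < \<tau>" "\<tau> < 1" and K\<tau>: "0 < K\<^sub>4 * \<tau>" "K\<^sub>4 * \<tau> < 1"
      using \<tau> K by (auto simp: field_simps)
    define s t where "s = real n * \<tau>" and "t = real (Suc n) * \<tau>"
    have st: "0 \<le> s" "s < t" "t - s = \<tau>"
      using \<tau>01 by (auto simp: s_def t_def algebra_simps)
    define \<delta> where "\<delta> \<omega> = W t \<omega> - W s \<omega>" for \<omega>
    define a where "a x = P \<tau> x + \<tau> *\<^sub>R b\<tau> \<tau> (P \<tau> x)" for x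
    define f where "f x z = ennreal (norm (a x + (\<Sum>j\<in>UNIV. (z $ j) *\<^sub>R \<sigma>\<tau> \<tau> j (P \<tau> x))) ^ (2 * p))"
      for x and z :: "real ^ 'm"
    have W: "W r \<in> borel_measurable M" if "0 \<le> r" for r
    proof (rule measurable_from_subalg)
      show "subalgebra M (F r)"
        using assms(1) that by (simp add: complete_filtered_prob_space_def)
      show "W r \<in> borel_measurable (F r)"
        using assms(2) that by (simp add: wiener_process_def)
    qed
    have [measurable]: "W s \<in> borel_measurable M" "W t \<in> borel_measurable M"
      using W st by auto
    have [measurable]: "\<delta> \<in> borel_measurable M"
      unfolding \<delta>_def by measurable
    have f_meas[measurable]: "(\<lambda>(x, z). f x z) \<in> borel_measurable (borel \<Otimes>\<^sub>M borel)"
    proof -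
      have [measurable]: "(\<lambda>(x, z). a x + (\<Sum>j\<in>UNIV. (z $ j) *\<^sub>R \<sigma>\<tau> \<tau> j (P \<tau> x)))
          \<in> borel_measurable (borel \<Otimes>\<^sub>M (borel :: (real ^ 'm) measure))"
        unfolding a_def using assms(5) \<tau>01
        by (intro euler_step_measurable) (auto simp: mem_measurable_def)
      show ?thesis
        unfolding f_def by measurable
    qed
    have indep: "indep_set (sets (F s)) (sets (vimage_algebra (space M) \<delta> borel))"
        "indep_vars (\<lambda>_. borel) (\<lambda>j \<omega>. \<delta> \<omega> $ j) UNIV"
      and dist: "\<And>j. distributed M lborel (\<lambda>\<omega>. \<delta> \<omega> $ j) (\<lambda>x. ennreal (normal_density 0 (sqrt \<tau>) x))"
      using assms(2)[unfolded wiener_process_def] st(1,2) unfolding \<delta>_def[abs_def] st(3)[symmetric] by blast+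
    \<comment> \<open>The estimate for a deterministic state \<open>x\<close>; the random iterate is
      substituted only after conditioning.\<close>
    have bound: "(\<integral>\<^sup>+z. f x z \<partial>distr M borel \<delta>) \<le> ennreal ((1 - K\<^sub>4 * \<tau> / 4) * norm x ^ (2 * p) + C * \<tau>)" for x
    proof -
      let ?y = "P \<tau> x"
      let ?S = "\<Sum>j\<in>UNIV. (norm (\<sigma>\<tau> \<tau> j ?y))\<^sup>2"
      have "(\<integral>\<^sup>+z. f x z \<partial>distr M borel \<delta>)
          = (\<integral>\<^sup>+z. f x (\<chi> j. z j) \<partial>(\<Pi>\<^sub>M j\<in>UNIV. normal_measure (sqrt \<tau>)))"
        by (rule nn_integral_indep_normal_components) (use indep dist in auto)
      also have "\<dots> \<le> ennreal (((norm (a x))\<^sup>2 + L * (sqrt \<tau>)\<^sup>2 * ?S) ^ p)"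
        unfolding f_def vec_lambda_beta using \<tau>01 L
        by (intro gaussian_norm_power_moment_le) (auto simp: L_def)
      also have "\<dots> \<le> ennreal ((1 - K\<^sub>4 * \<tau> / 4) * norm x ^ (2 * p) + C * \<tau>)"
      proof (rule ennreal_leI)
        have "((norm (a x))\<^sup>2 + L * (sqrt \<tau>)\<^sup>2 * ?S) ^ p \<le> ((1 - K\<^sub>4 * \<tau>) * (norm ?y)\<^sup>2 + K\<^sub>3 * \<tau>) ^ p"
          using mem_stable_drift_bound[OF assms(11) \<tau>01 L(2), of x] L \<tau>01
          by (intro power_mono) (auto simp: a_def intro!: add_nonneg_nonneg mult_nonneg_nonneg sum_nonneg)
        also have "\<dots> = ((1 - K\<^sub>4 * \<tau>) * (norm ?y)\<^sup>2 + K\<^sub>4 * \<tau> * (K\<^sub>3 / K\<^sub>4)) ^ p"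
          using K by (simp add: mult.commute)
        also have "\<dots> \<le> (1 - K\<^sub>4 * \<tau>) * ((norm ?y)\<^sup>2) ^ p + K\<^sub>4 * \<tau> * (K\<^sub>3 / K\<^sub>4) ^ p"
          using K K\<tau> by (intro convex_combination_power_le) auto
        also have "\<dots> = (1 - K\<^sub>4 * \<tau>) * norm ?y ^ (2 * p) + C * \<tau>"
          by (simp add: C_def power_mult)
        \<comment> \<open>Consistency supplies that \<open>P \<tau>\<close> does not increase the
          norm. The contraction factor obtained, \<open>1 - K\<^sub>4 * \<tau>\<close>, is smaller
          than the one claimed.\<close>
        also have "\<dots> \<le> (1 - K\<^sub>4 * \<tau> / 4) * norm x ^ (2 * p) + C * \<tau>"
        proof (intro add_right_mono mult_mono power_mono)
          show "norm ?y \<le> norm x"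
            using assms(9) \<tau>01 unfolding mem_consistent_def by blast
        qed (use K\<tau> in auto)
        finally show "((norm (a x))\<^sup>2 + L * (sqrt \<tau>)\<^sup>2 * ?S) ^ p
            \<le> (1 - K\<^sub>4 * \<tau> / 4) * norm x ^ (2 * p) + C * \<tau>" .
      qed
      finally show ?thesis .
    qed
    let ?Y = "mem P b\<tau> \<sigma>\<tau> W x0 \<tau> n"
    have sub: "subalgebra M (F s)"
      using assms(1) st by (simp add: complete_filtered_prob_space_def)
    have Y: "?Y \<in> borel_measurable (F s)"
      unfolding s_def by (rule mem_adapted) (use assms \<tau>01 in auto)
    \<comment> \<open>Freezing applies because the iterate is known at time \<open>s\<close> and the
      increment \<open>\<delta>\<close> is independent of \<open>F s\<close>.\<close>
    have "AE \<omega> in M. nn_cond_exp M (F s) (\<lambda>\<omega>. f (?Y \<omega>) (\<delta> \<omega>)) \<omega> = (\<integral>\<^sup>+z. f (?Y \<omega>) z \<partial>distr M borel \<delta>)"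
      by (rule nn_cond_exp_indep[OF sub Y _ indep(1)]) measurable
    moreover have "ennreal (norm (mem P b\<tau> \<sigma>\<tau> W x0 \<tau> (Suc n) \<omega>) ^ (2 * p)) = f (?Y \<omega>) (\<delta> \<omega>)" for \<omega>
      by (simp add: f_def a_def \<delta>_def s_def t_def)
    ultimately show ?thesis
      unfolding s_def[symmetric] using bound by (auto elim!: eventually_mono)
  qed
  ultimately show ?thesis by blast
qed

end
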